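(* Consider a quantum plant with noise input $\mathcal{A}$ and control input $\mathcal{U}$, $$\begin{bmatrix} da\\ da^{\#}\end{bmatrix}=F\begin{bmatrix} a\\ a^{\#}\end{bmatrix}dt+[G_1\ \ G_2]\begin{bmatrix} d\mathcal{A}\\ d\mathcal{A}^{\#}\\ d\mathcal{U}\\ d\mathcal{U}^{\#}\end{bmatrix},\quad \begin{bmatrix} d\mathcal{Y}\\ d\mathcal{Y}^{\#}\end{bmatrix}=H\begin{bmatrix} a\\ a^{\#}\end{bmatrix}dt+[K\ \ 0]\begin{bmatrix} d\mathcal{A}\\ d\mathcal{A}^{\#}\\ d\mathcal{U}\\ d\mathcal{U}^{\#}\end{bmatrix},\quad z=C\begin{bmatrix} a\\ a^{\#}\end{bmatrix},$$ and a coherent controller with feedback $$\begin{bmatrix} da_c\\ da_c^{\#}\end{bmatrix}=F_c\begin{bmatrix} a_c\\ a_c^{\#}\end{bmatrix}dt+[G_{c1}\ \ G_{c2}]\begin{bmatrix} d\tilde{\mathcal{A}}\\ d\tilde{\mathcal{A}}^{\#}\\ d\mathcal{Y}\\ d\mathcal{Y}^{\#}\end{bmatrix},\quad \begin{bmatrix} d\tilde{\mathcal{Y}}\\ d\tilde{\mathcal{Y}}^{\#}\\ d\mathcal{U}\\ d\mathcal{U}^{\#}\end{bmatrix}=\begin{bmatrix}\tilde H_c\\ H_c\end{bmatrix}\begin{bmatrix} a_c\\ a_c^{\#}\end{bmatrix}dt+\begin{bmatrix}\tilde K_{c1}&\tilde K_{c2}\\ K_{c1}&K_{c2}\end{bmatrix}\begin{bmatrix}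 d\tilde{\mathcal{A}}\\ d\tilde{\mathcal{A}}^{\#}\\ d\mathcal{Y}\\ d\mathcal{Y}^{\#}\end{bmatrix}.$$ Suppose that both the plant and the controller are physically realizable annihilation operator only systems. Let $\tilde J_c$ be the cost of the coherent-classical estimation scheme with coherent feedback (the output $\tilde{\mathcal{Y}}$ of the plant-controller interconnection is homodyne detected at angles $\tilde\theta_1,\dots,\tilde\theta_{\tilde m}$ and followed by the optimal classical estimator), and let $\bar J_c$ be the cost of the corresponding purely-classical estimation scheme for the plant (the plant output $\mathcal{Y}$ is homodyne detected at angles $\theta_1,\dots,\theta_m$ and followed by the optimal classical estimator). (Both costs are defined through algebraic Riccati equations in the context.) Then $$\tilde J_c=\bar J_c .$$
   Context: **Notation.** $X^{\#}$ is the entrywise complex conjugate of a complex matrix (entrywise operator adjoint for a vector of operators), $X^T$ the transpose, $X^\dagger=(X^{\#})^T$. $\Delta(X_1,X_2)=\begin{bmatrix} X_1&X_2\\ X_2^{\#}&X_1^{\#}\end{bmatrix}$. $\iota=\sqrt{-1}$. $a$ is a vector of $n$ annihilation operators of the plant, $a_c$ a vector of annihilation operators of the controller; $\mathcal{A},\tilde{\mathcal{A}}$ are quantum noise fields, $\mathcal{Y},\tilde{\mathcal{Y}}$ output fields; $z$ is the quantity to be estimated and $C$ is a complex $1\times 2n$ row vector. $\mathcal{A},\mathcal{Y},\mathcal{U}$ have $m$ components and $\tilde{\mathcal{A}},\tilde{\mathcal{Y}}$ have $\tilde m$ components. **Annihilation operator only systems.** All coefficient blocks of the plant and of the controller ($F,G_1,G_2,H,K$;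 $F_c,G_{c1},G_{c2},\tilde H_c,H_c$, and the $K$-blocks) have the form $\Delta(\cdot,\cdot)$; the system is annihilation operator only when the second argument of each of these $\Delta$'s is $0$. **Physical realizability (annihilation operator only).** An annihilation operator only system $da=\mathsf{F}a\,dt+\mathsf{G}\,d\mathcal{W}$, $d\mathcal{W}^{out}=\mathsf{H}a\,dt+\mathsf{K}\,d\mathcal{W}$ (with as many outputs as inputs) is physically realizable iff there is a complex commutation matrix $\Theta_1=\Theta_1^\dagger>0$ (with $\Theta_1=[a,a^\dagger]$) such that $\mathsf{F}\Theta_1+\Theta_1\mathsf{F}^\dagger+\mathsf{G}\mathsf{G}^\dagger=0$, $\mathsf{G}=-\Theta_1\mathsf{H}^\dagger$, $\mathsf{K}=I$. In doubled-up form, with commutation matrices of the form $\Delta(\cdot,0)>0$, this means the following. - *Plant.* The plant is augmented with an unused output $\begin{bmatrix} d\bar{\mathcal{Y}}\\ d\bar{\mathcal{Y}}^{\#}\end{bmatrix}=\bar H\begin{bmatrix} a\\ a^{\#}\end{bmatrix}dt+\bar K\begin{bmatrix} d\mathcal{U}\\ d\mathcal{U}^{\#}\end{bmatrix}$ so as to have as many outputs as inputs, and is physically realizable when, for some such $\bar H$ (of the form $\Delta(\cdot,0)$), there is $\Theta=\Theta^\dagger>0$ with $F\Theta+\Theta F^\dagger+G_1G_1^\dagger+G_2G_2^\dagger=0$, $G_1=-\Theta H^\dagger$, $G_2=-\Theta\bar H^\dagger$, $K=I$, $\bar K=I$. - *Controller.* It is physically realizable when there is $\Theta_c=\Theta_c^\dagger>0$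 with $F_c\Theta_c+\Theta_cF_c^\dagger+G_{c1}G_{c1}^\dagger+G_{c2}G_{c2}^\dagger=0$, $G_{c1}=-\Theta_c\tilde H_c^\dagger$, $G_{c2}=-\Theta_cH_c^\dagger$, and $\begin{bmatrix}\tilde K_{c1}&\tilde K_{c2}\\ K_{c1}&K_{c2}\end{bmatrix}=I$, i.e. $\tilde K_{c1}=K_{c2}=I$, $K_{c1}=\tilde K_{c2}=0$. **Standing assumption.** The quantum noises are purely canonical ($d\mathcal{A}\,d\mathcal{A}^\dagger=I\,dt$, and likewise for the other external fields); $K=I$. In the purely-classical scheme $\mathcal{U}$ is treated as an external canonical quantum noise. **Homodyne detection.** Measuring $\mathcal{Y}$ at angles $\theta_1,\dots,\theta_m$ gives $dy_i=\tfrac12e^{-\iota\theta_i}d\mathcal{Y}_i+\tfrac12e^{\iota\theta_i}d\mathcal{Y}_i^{*}$, i.e. $dy=L\begin{bmatrix} d\mathcal{Y}\\ d\mathcal{Y}^{\#}\end{bmatrix}$, $L=[L_1\ \ L_2]$, $L_1=\tfrac12\mathrm{diag}(e^{-\iota\theta_1},\dots,e^{-\iota\theta_m})$, $L_2=\tfrac12\mathrm{diag}(e^{\iota\theta_1},\dots,e^{\iota\theta_m})$. Measuring $\tilde{\mathcal{Y}}$ gives $d\tilde y=\tilde L\begin{bmatrix} d\tilde{\mathcal{Y}}\\ d\tilde{\mathcal{Y}}^{\#}\end{bmatrix}$, where $\tilde L=[\tilde L_1\ \ \tilde L_2]$ is defined in the same way with the angles $\tilde\theta_1,\dots,\tilde\theta_{\tilde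 m}$. **Optimal classical estimator and cost.** A classical estimator is $dx_e=F_ex_e\,dt+G_e\,dy$, $\hat z=H_ex_e$ (driven by $d\tilde y$ in the coherent-classical case). The optimal one minimizes the mean-square error $\lim_{t\to\infty}\langle e^*(t)e(t)\rangle$, $e=z-\hat z$, where $\langle\cdot\rangle$ is the quantum expectation over the joint quantum-classical system. It is given by the standard (complex) Kalman filter for the measured system. For a system with matrices $(F_a,G_a,H_a,K_a)$ and measurement matrix $M$ it is obtained from the solution $P$ to the algebraic Riccati equation $$F_aP+PF_a^\dagger+G_aG_a^\dagger-(G_aK_a^\dagger+PH_a^\dagger)M^\dagger(MK_aK_a^\dagger M^\dagger)^{-1}M(G_aK_a^\dagger+PH_a^\dagger)^\dagger=0 .$$ - *Purely-classical scheme:* $F_a=F$, $G_a=[G_1\ \ G_2]$, $H_a=H$, $K_a=[K\ \ 0]=[I\ \ 0]$, $M=L$, i.e. the solution $\bar P_e$ of $$F\bar P_e+\bar P_eF^\dagger+G_1G_1^\dagger+G_2G_2^\dagger-(G_1+\bar P_eH^\dagger)L^\dagger(LL^\dagger)^{-1}L(G_1+\bar P_eH^\dagger)^\dagger=0;$$ the cost is $\bar J_c=C\bar P_eC^\dagger$. - *Coherent-classical scheme with feedback:* $$F_a=\begin{bmatrix} F+G_2K_{c2}H&G_2H_c\\ G_{c2}H&F_c\end{bmatrix},\quad G_a=\begin{bmatrix} G_1+G_2K_{c2}K&G_2K_{c1}\\ G_{c2}K&G_{c1}\end{bmatrix},$$ $$H_a=[\tilde K_{c2}H\ \ \tilde H_c],\quad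 K_a=[\tilde K_{c2}K\ \ \tilde K_{c1}],\quad M=\tilde L,$$ with solution $\tilde P_e=\begin{bmatrix} P_1&P_2\\ P_2^\dagger&P_3\end{bmatrix}$, $P_1$ of the same size $2n\times2n$ as $\bar P_e$; the cost is $\tilde J_c=[C\ \ 0]\,\tilde P_e\,[C\ \ 0]^\dagger=CP_1C^\dagger$.
   Formalization: The solution of each Riccati equation is taken to be the Hermitian stabilizing one (stable estimation-error dynamics), assumed to exist in both schemes; for other solutions, or with undamped isolated modes, the Riccati equation does not determine the cost. *)

theory Defs
  imports "HOL-Analysis.Analysis"
begin

section \<open>Complex matrices in block form\<close>

definition dagger :: "complex^'c^'r \<Rightarrow> complex^'r^'c"  ("(_\<^sup>\<dagger>)" [1000] 999)
  where "X\<^sup>\<dagger> = transpose (map_matrix cnj X)"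

text \<open>Block rows and columns are indexed by sum types, \<open>Inl\<close> being the first block.\<close>

definition hcat :: "complex^'a^'r \<Rightarrow> complex^'b^'r \<Rightarrow> complex^('a + 'b)^'r"
  where "hcat A B = (\<chi> i j. case j of Inl a \<Rightarrow> A $ i $ a | Inr b \<Rightarrow> B $ i $ b)"

definition vcat :: "complex^'c^'a \<Rightarrow> complex^'c^'b \<Rightarrow> complex^'c^('a + 'b)"
  where "vcat A B = (\<chi> i. case i of Inl a \<Rightarrow> A $ a | Inr b \<Rightarrow> B $ b)"

definition block_mat ::
  "complex^'c^'a \<Rightarrow> complex^'d^'a \<Rightarrow> complex^'c^'b \<Rightarrow> complex^'d^'b \<Rightarrow> complex^('c + 'd)^('a + 'b)"
  where "block_mat A B C D = vcat (hcat A B) (hcat C D)"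

definition Delta :: "complex^'c^'r \<Rightarrow> complex^'c^'r \<Rightarrow> complex^('c + 'c)^('r + 'r)"  ("\<Delta>")
  where "\<Delta> X1 X2 = block_mat X1 X2 (map_matrix cnj X2) (map_matrix cnj X1)"

definition annihilation_only :: "complex^('c::finite + 'c)^('r::finite + 'r) \<Rightarrow> bool"
  where "annihilation_only X \<longleftrightarrow> (\<exists>X1. X = \<Delta> X1 0)"

definition hermitian :: "complex^'n^'n \<Rightarrow> bool"
  where "hermitian A \<longleftrightarrow> A\<^sup>\<dagger> = A"

definition positive_definite :: "complex^'n^'n \<Rightarrow> bool"
  where "positive_definite A \<longleftrightarrow>
    hermitian A \<and> (\<forall>v. v \<noteq> 0 \<longrightarrow> 0 < Re (\<Sum>i\<in>UNIV. cnj (v $ i) * (A *v v) $ i))"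

definition hurwitz :: "complex^'n^'n \<Rightarrow> bool"
  where "hurwitz A \<longleftrightarrow> (\<forall>c v. v \<noteq> 0 \<and> A *v v = c *s v \<longrightarrow> Re c < 0)"

section \<open>Physical realizability\<close>

text \<open>
  A linear quantum system with as many outputs as inputs is given by its doubled-up
  coefficients \<open>(F, G, H, K)\<close>.  The index type \<open>'w\<close> lists all field channels; it is a
  sum of doubled-up channels such as \<open>('m + 'm) + ('k + 'k)\<close>.
\<close>

definition physically_realizable ::
  "complex^('n::finite + 'n)^('n + 'n) \<Rightarrow> complex^'w^('n + 'n) \<Rightarrow> complex^('n + 'n)^'w \<Rightarrow> complex^'w^'w \<Rightarrow> bool"
  where "physically_realizable F G H K \<longleftrightarrow>
    (\<exists>\<Theta>. annihilation_only \<Theta> \<and> positive_definite \<Theta> \<and>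
      F ** \<Theta> + \<Theta> ** F\<^sup>\<dagger> + G ** G\<^sup>\<dagger> = 0 \<and>
      G = - (\<Theta> ** H\<^sup>\<dagger>) \<and>
      K = mat 1)"

definition plant_realizable ::
  "complex^('n::finite + 'n)^('n + 'n) \<Rightarrow> complex^('m::finite + 'm)^('n + 'n) \<Rightarrow> complex^('m + 'm)^('n + 'n) \<Rightarrow>
   complex^('n + 'n)^('m + 'm) \<Rightarrow> complex^('m + 'm)^('m + 'm) \<Rightarrow> bool"
  where "plant_realizable F G1 G2 H K \<longleftrightarrow>
    (\<exists>Hbar Kbar. annihilation_only Hbar \<and> annihilation_only Kbar \<and>
      physically_realizable F (hcat G1 G2) (vcat H Hbar) (block_mat K 0 0 Kbar))"

section \<open>Homodyne detection and the optimal classical estimator\<close>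

definition homodyne :: "real^'m \<Rightarrow> complex^('m + 'm)^'m"
  where "homodyne \<theta> = hcat (\<chi> i j. if i = j then cis (- (\<theta> $ i)) / 2 else 0)
                            (\<chi> i j. if i = j then cis (\<theta> $ i) / 2 else 0)"

definition kalman_gain ::
  "complex^'w^'s \<Rightarrow> complex^'s^'y \<Rightarrow> complex^'w^'y \<Rightarrow> complex^'y^'p \<Rightarrow> complex^'s^'s \<Rightarrow> complex^'p^'s"
  where "kalman_gain G H K M P =
    (G ** K\<^sup>\<dagger> + P ** H\<^sup>\<dagger>) ** M\<^sup>\<dagger> ** matrix_inv (M ** K ** K\<^sup>\<dagger> ** M\<^sup>\<dagger>)"

text \<open>
  An algebraic Riccati equation has in general several Hermitian (even several positive
  semidefinite) solutions.  The steady-state error covariance of the Kalman filter is the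
  stabilizing one, i.e. the one for which the error dynamics \<open>F - (gain) M H\<close> is
  asymptotically stable; it is unique if it exists.
\<close>

definition kalman_covariance ::
  "complex^'s^'s \<Rightarrow> complex^'w^'s \<Rightarrow> complex^'s^'y \<Rightarrow> complex^'w^'y \<Rightarrow> complex^'y^'p \<Rightarrow>
   complex^'s^'s \<Rightarrow> bool"
  where "kalman_covariance F G H K M P \<longleftrightarrow>
    hermitian P \<and>
    F ** P + P ** F\<^sup>\<dagger> + G ** G\<^sup>\<dagger>
      - (G ** K\<^sup>\<dagger> + P ** H\<^sup>\<dagger>) ** M\<^sup>\<dagger> ** matrix_inv (M ** K ** K\<^sup>\<dagger> ** M\<^sup>\<dagger>) ** M
          ** (G ** K\<^sup>\<dagger> + P ** H\<^sup>\<dagger>)\<^sup>\<dagger> = 0 \<and>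
    hurwitz (F - kalman_gain G H K M P ** M ** H)"

text \<open>
  \<open>J\<close> is the steady-state mean-square error of the optimal classical estimate of
  \<open>z = C x\<close> from the measured output.
\<close>

definition is_estimation_cost ::
  "complex^'s^'s \<Rightarrow> complex^'w^'s \<Rightarrow> complex^'s^'y \<Rightarrow> complex^'w^'y \<Rightarrow> complex^'y^'p \<Rightarrow>
   complex^'s^1 \<Rightarrow> complex \<Rightarrow> bool"
  where "is_estimation_cost F G H K M C J \<longleftrightarrow>
    (\<exists>P. kalman_covariance F G H K M P \<and> J = (C ** P ** C\<^sup>\<dagger>) $ 1 $ 1)"

end

theory Submission
  imports Defs "HOL-Computational_Algebra.Fundamental_Theorem_Algebra"
begin

text \<open>
  A commutation matrix \<open>\<Theta>\<close> of a physically realizable system solves the Riccati equation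
  with vanishing Kalman gain, because \<open>G K\<^sup>\<dagger> + \<Theta> H\<^sup>\<dagger> = 0\<close>.  If \<open>P\<close> is the
  stabilizing solution and \<open>A\<close> its closed-loop matrix, then \<open>X = P - \<Theta>\<close> satisfies the
  Sylvester equation \<open>A X + X F\<^sup>\<dagger> = 0\<close>.  As \<open>A\<close> is Hurwitz and \<open>F\<close> has no eigenvalue in the
  open right half-plane (Lyapunov), \<open>X = 0\<close>.  For the feedback interconnection the block diagonal
  of the two commutation matrices plays the role of \<open>\<Theta>\<close>, so both error covariances of the
  plant equal the commutation matrix of the plant.
\<close>

section \<open>Matrix algebra\<close>

lemma matrix_mul_minus_left: "(- A) ** B = - (A ** B)" for A :: "complex^'b^'a"
  by (simp add: matrix_matrix_mult_def vec_eq_iff sum_negf)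

lemma matrix_mul_minus_right: "A ** (- B) = - (A ** B)" for A :: "complex^'b^'a"
  by (simp add: matrix_matrix_mult_def vec_eq_iff sum_negf)

lemma matrix_add_rdistrib: "(A + B) ** C = A ** C + B ** C" for A :: "complex^'b^'a"
  by (simp add: matrix_matrix_mult_def vec_eq_iff sum.distrib distrib_right)

lemma matrix_diff_ldistrib: "A ** (B - C) = A ** B - A ** C" for A :: "complex^'b^'a"
  by (simp add: matrix_matrix_mult_def vec_eq_iff sum_subtractf right_diff_distrib)

lemma matrix_diff_rdistrib: "(A - B) ** C = A ** C - B ** C" for A :: "complex^'b^'a"
  by (simp add: matrix_matrix_mult_def vec_eq_iff sum_subtractf left_diff_distrib)

lemma mat_mult_nth: "(mat c ** X) $ i $ j = c * X $ i $ j" for X :: "complex^'b^'a"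
  by (simp add: matrix_matrix_mult_def mat_def if_distrib if_distribR sum.delta' cong: if_cong)

lemma mult_mat_nth: "(X ** mat c) $ i $ j = c * X $ i $ j" for X :: "complex^'b^'a"
  by (simp add: matrix_matrix_mult_def mat_def if_distrib if_distribR sum.delta cong: if_cong)

lemma mat_mult_commute: "mat c ** X = X ** mat c" for X :: "complex^'b^'a"
  by (simp add: vec_eq_iff mat_mult_nth mult_mat_nth)

section \<open>Conjugate transpose\<close>

lemma dagger_nth: "X\<^sup>\<dagger> $ i $ j = cnj (X $ j $ i)"
  by (simp add: dagger_def transpose_def map_matrix_def)

lemma dagger_dagger [simp]: "(X\<^sup>\<dagger>)\<^sup>\<dagger> = X"
  by (simp add: vec_eq_iff dagger_nth)

lemma dagger_add: "(X + Y)\<^sup>\<dagger> = X\<^sup>\<dagger> + Y\<^sup>\<dagger>"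
  by (simp add: vec_eq_iff dagger_nth)

lemma dagger_diff: "(X - Y)\<^sup>\<dagger> = X\<^sup>\<dagger> - Y\<^sup>\<dagger>"
  by (simp add: vec_eq_iff dagger_nth)

lemma dagger_minus: "(- X)\<^sup>\<dagger> = - X\<^sup>\<dagger>"
  by (simp add: vec_eq_iff dagger_nth)

lemma dagger_zero [simp]: "0\<^sup>\<dagger> = 0"
  by (simp add: vec_eq_iff dagger_nth)

lemma dagger_mat: "(mat c)\<^sup>\<dagger> = mat (cnj c)"
  by (simp add: vec_eq_iff dagger_nth mat_def)

lemma dagger_mult: "(X ** Y)\<^sup>\<dagger> = Y\<^sup>\<dagger> ** X\<^sup>\<dagger>"
  by (simp add: vec_eq_iff dagger_nth matrix_matrix_mult_def mult.commute)

section \<open>Block matrices over sum-type indices\<close>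

lemma sum_UNIV_sum: "(\<Sum>k\<in>UNIV. f k) = (\<Sum>k\<in>UNIV. f (Inl k)) + (\<Sum>k\<in>UNIV. f (Inr k))"
  for f :: "'a::finite + 'b::finite \<Rightarrow> 'c::comm_monoid_add"
  using sum.Plus[of "UNIV :: 'a set" "UNIV :: 'b set" f] by (simp add: UNIV_Plus_UNIV)

lemma hcat_mult_vcat: "hcat A B ** vcat C D = A ** C + B ** D"
  for A :: "complex^'a::finite^'r" and B :: "complex^'b::finite^'r"
  by (simp add: vec_eq_iff hcat_def vcat_def matrix_matrix_mult_def sum_UNIV_sum)

lemma mult_hcat: "X ** hcat A B = hcat (X ** A) (X ** B)"
  by (auto simp: vec_eq_iff hcat_def matrix_matrix_mult_def split: sum.split)

lemma vcat_mult: "vcat A B ** X = vcat (A ** X) (B ** X)"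
  by (auto simp: vec_eq_iff vcat_def matrix_matrix_mult_def split: sum.split)

lemma dagger_hcat: "(hcat A B)\<^sup>\<dagger> = vcat (A\<^sup>\<dagger>) (B\<^sup>\<dagger>)"
  by (auto simp: vec_eq_iff dagger_nth hcat_def vcat_def split: sum.split)

lemma dagger_vcat: "(vcat A B)\<^sup>\<dagger> = hcat (A\<^sup>\<dagger>) (B\<^sup>\<dagger>)"
  by (auto simp: vec_eq_iff dagger_nth hcat_def vcat_def split: sum.split)

lemma hcat_add: "hcat A B + hcat C D = hcat (A + C) (B + D)"
  by (auto simp: vec_eq_iff hcat_def split: sum.split)

lemma vcat_add: "vcat A B + vcat C D = vcat (A + C) (B + D)"
  by (auto simp: vec_eq_iff vcat_def split: sum.split)

lemma hcat_vcat: "hcat (vcat A B) (vcat C D) = vcat (hcat A C) (hcat B D)"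
  by (auto simp: vec_eq_iff hcat_def vcat_def split: sum.split)

lemma hcat_minus: "- hcat A B = hcat (- A) (- B)"
  by (auto simp: vec_eq_iff hcat_def split: sum.split)

lemma hcat_zero: "hcat 0 0 = 0"
  by (auto simp: vec_eq_iff hcat_def split: sum.split)

lemma vcat_zero: "vcat 0 0 = 0"
  by (auto simp: vec_eq_iff vcat_def split: sum.split)

lemma hcat_eq_iff: "hcat A B = hcat C D \<longleftrightarrow> A = C \<and> B = D"
proof
  assume eq: "hcat A B = hcat C D"
  have "hcat A B $ i $ Inl j = hcat C D $ i $ Inl j" "hcat A B $ i $ Inr k = hcat C D $ i $ Inr k" for i j k
    by (simp_all add: eq)
  then show "A = C \<and> B = D"
    by (simp add: hcat_def vec_eq_iff)
qed simp

lemma vcat_eq_iff: "vcat A B = vcat C D \<longleftrightarrow> A = C \<and> B = D"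
proof
  assume eq: "vcat A B = vcat C D"
  have "vcat A B $ Inl i = vcat C D $ Inl i" "vcat A B $ Inr j = vcat C D $ Inr j" for i j
    by (simp_all add: eq)
  then show "A = C \<and> B = D"
    by (simp add: vcat_def vec_eq_iff)
qed simp

lemma mat_eq_block_mat: "mat c = block_mat (mat c) 0 0 (mat c)"
  by (auto simp: vec_eq_iff block_mat_def hcat_def vcat_def mat_def split: sum.split)

lemmas block_simps = block_mat_def hcat_mult_vcat mult_hcat vcat_mult dagger_hcat dagger_vcat
  hcat_add vcat_add hcat_vcat

section \<open>Positive definite matrices\<close>

text \<open>Conjugate-linear in the first argument, so \<open>cinner v (A *v v)\<close> is the
  quadratic form in \<open>positive_definite\<close>.\<close>

definition cinner :: "complex^'n \<Rightarrow> complex^'n \<Rightarrow> complex"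
  where "cinner u v = (\<Sum>i\<in>UNIV. cnj (u $ i) * v $ i)"

lemma cinner_add_right: "cinner u (v + w) = cinner u v + cinner u w"
  by (simp add: cinner_def sum.distrib distrib_left)

lemma cinner_scale_right: "cinner u (c *s v) = c * cinner u v"
  by (simp add: cinner_def sum_distrib_left mult.left_commute)

lemma cinner_commute: "cinner v u = cnj (cinner u v)"
  by (simp add: cinner_def mult.commute)

lemma cinner_adjoint: "cinner u (A *v w) = cinner (A\<^sup>\<dagger> *v u) w"
proof -
  have "cinner u (A *v w) = (\<Sum>i\<in>UNIV. \<Sum>j\<in>UNIV. cnj (u $ i) * (A $ i $ j * w $ j))"
    by (simp add: cinner_def matrix_vector_mult_def sum_distrib_left)
  also have "\<dots> = (\<Sum>j\<in>UNIV. \<Sum>i\<in>UNIV. cnj (u $ i) * (A $ i $ j * w $ j))"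
    by (rule sum.swap)
  also have "\<dots> = cinner (A\<^sup>\<dagger> *v u) w"
    by (simp add: cinner_def matrix_vector_mult_def sum_distrib_left sum_distrib_right dagger_nth ac_simps)
  finally show ?thesis .
qed

lemma cinner_zero [simp]: "cinner 0 u = 0" "cinner u 0 = 0"
  by (simp_all add: cinner_def)

lemma cinner_self_nonneg: "0 \<le> Re (cinner u u)"
  unfolding cinner_def Re_sum by (intro sum_nonneg) simp

lemma positive_definite_cinner:
  "positive_definite A \<longleftrightarrow> A\<^sup>\<dagger> = A \<and> (\<forall>v. v \<noteq> 0 \<longrightarrow> 0 < Re (cinner v (A *v v)))"
  by (simp add: positive_definite_def hermitian_def cinner_def)

text \<open>Positivity makes the kernel trivial, and a left inverse of a square matrix is also a
  right inverse. This allows an eigenvector to be written as \<open>\<Theta> *v u\<close>.\<close>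

lemma positive_definite_surj:
  assumes "positive_definite A"
  obtains u where "A *v u = w"
proof -
  have "v = 0" if "A *v v = 0" for v
    using assms that by (force simp: positive_definite_cinner cinner_def)
  then obtain B where "B ** A = mat 1"
    using matrix_left_invertible_ker[of A] by blast
  then have "A ** B = mat 1"
    by (simp add: matrix_left_right_inverse)
  then have "A *v (B *v w) = w"
    by (simp add: matrix_vector_mul_assoc)
  then show thesis
    by (rule that)
qed

text \<open>Write the eigenvector as \<open>w = \<Theta> *v u\<close> and evaluate the quadratic
  form of the Lyapunov equation at \<open>u\<close>: twice \<open>Re d\<close> times the positive
  number \<open>cinner u (\<Theta> *v u)\<close>, plus the squared norm of
  \<open>G\<^sup>\<dagger> *v u\<close>, is zero. That norm may vanish, so only the weak inequality
  follows.\<close>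

lemma lyapunov_eigenvalue:
  assumes pd: "positive_definite \<Theta>"
    and lyap: "F ** \<Theta> + \<Theta> ** F\<^sup>\<dagger> + G ** G\<^sup>\<dagger> = 0"
    and ev: "F *v w = d *s w" "w \<noteq> 0"
  shows "Re d \<le> 0"
proof -
  from pd obtain u where u: "\<Theta> *v u = w"
    by (rule positive_definite_surj)
  define r where "r = cinner u w"
  have herm: "\<Theta>\<^sup>\<dagger> = \<Theta>"
    using pd by (simp add: positive_definite_cinner)
  have "u \<noteq> 0"
    using u ev by auto
  then have pos: "0 < Re r"
    using pd u by (auto simp: positive_definite_cinner r_def)
  \<comment> \<open>As \<open>\<Theta>\<close> is Hermitian, \<open>r\<close> is real; hence the two
    Lyapunov terms become \<open>d * r\<close> and \<open>cnj d * r\<close> with the same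
    \<open>r\<close>.\<close>
  have real: "cnj r = r"
    using cinner_adjoint[of u \<Theta> u] by (simp add: r_def herm u flip: cinner_commute)
  have "cinner u (F *v (\<Theta> *v u)) = d * r"
    by (simp add: u ev cinner_scale_right r_def)
  moreover have "cinner u (\<Theta> *v (F\<^sup>\<dagger> *v u)) = cnj d * r"
  proof -
    have "cinner u (\<Theta> *v (F\<^sup>\<dagger> *v u)) = cinner (F *v w) u"
      using cinner_adjoint[of u \<Theta> "F\<^sup>\<dagger> *v u"] cinner_adjoint[of w "F\<^sup>\<dagger>" u] by (simp add: herm u)
    also have "\<dots> = cnj (d * r)"
      by (simp add: ev cinner_scale_right r_def cinner_commute[of _ u])
    finally show ?thesis
      by (simp add: real)
  qed
  moreover have "cinner u (G *v (G\<^sup>\<dagger> *v u)) = cinner (G\<^sup>\<dagger> *v u) (G\<^sup>\<dagger> *v u)"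
    by (rule cinner_adjoint)
  moreover have "(F ** \<Theta> + \<Theta> ** F\<^sup>\<dagger> + G ** G\<^sup>\<dagger>) *v u
      = F *v (\<Theta> *v u) + \<Theta> *v (F\<^sup>\<dagger> *v u) + G *v (G\<^sup>\<dagger> *v u)"
    by (simp add: matrix_vector_mult_add_rdistrib matrix_vector_mul_assoc)
  then have "cinner u (F *v (\<Theta> *v u)) + cinner u (\<Theta> *v (F\<^sup>\<dagger> *v u))
      + cinner u (G *v (G\<^sup>\<dagger> *v u)) = 0"
    unfolding lyap by (metis cinner_add_right cinner_zero(2) matrix_vector_mult_0)
  ultimately have "(d + cnj d) * r + cinner (G\<^sup>\<dagger> *v u) (G\<^sup>\<dagger> *v u) = 0"
    by (simp add: distrib_right)
  then have "Re ((d + cnj d) * r) + Re (cinner (G\<^sup>\<dagger> *v u) (G\<^sup>\<dagger> *v u)) = 0"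
    by (metis plus_complex.sel(1) zero_complex.sel(1))
  with cinner_self_nonneg[of "G\<^sup>\<dagger> *v u"] have "2 * Re d * Re r \<le> 0"
    by simp
  with pos show ?thesis
    by (simp add: mult_le_0_iff)
qed

text \<open>The quadratic form splits into the forms of \<open>A\<close> and \<open>B\<close> at the
  two halves of the vector, at least one of which is nonzero.\<close>

lemma positive_definite_block_diag:
  assumes "positive_definite A" "positive_definite B"
  shows "positive_definite (block_mat A 0 0 B)"
  unfolding positive_definite_cinner
proof (intro conjI allI impI)
  show "(block_mat A 0 0 B)\<^sup>\<dagger> = block_mat A 0 0 B"
    using assms
    by (auto simp: positive_definite_cinner vec_eq_iff dagger_nth block_mat_def hcat_def vcat_def
        split: sum.split)
next
  fix v :: "complex^('a + 'b)"
  assume "v \<noteq> 0"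
  define x where "x = (\<chi> i. v $ Inl i)"
  define y where "y = (\<chi> i. v $ Inr i)"
  have "x \<noteq> 0 \<or> y \<noteq> 0"
  proof (rule ccontr)
    assume "\<not> (x \<noteq> 0 \<or> y \<noteq> 0)"
    then have "v $ i = 0" for i
      by (cases i) (simp_all add: x_def y_def vec_eq_iff)
    with \<open>v \<noteq> 0\<close> show False
      by (simp add: vec_eq_iff)
  qed
  moreover have "cinner v (block_mat A 0 0 B *v v) = cinner x (A *v x) + cinner y (B *v y)"
    by (simp add: cinner_def x_def y_def block_mat_def hcat_def vcat_def matrix_vector_mult_def
        sum_UNIV_sum)
  moreover have "x \<noteq> 0 \<Longrightarrow> 0 < Re (cinner x (A *v x))" "y \<noteq> 0 \<Longrightarrow> 0 < Re (cinner y (B *v y))"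
    using assms by (auto simp: positive_definite_cinner)
  ultimately show "0 < Re (cinner v (block_mat A 0 0 B *v v))"
    by (cases "x = 0"; cases "y = 0") (simp_all add: add_pos_pos)
qed

section \<open>The Sylvester equation\<close>

text \<open>Horner evaluation of a scalar polynomial at \<open>A\<close> with respect to
  \<open>**\<close>; a coefficient \<open>a\<close> enters as the scalar matrix
  \<open>mat a\<close>.\<close>

definition mat_poly :: "complex^'n^'n \<Rightarrow> complex poly \<Rightarrow> complex^'n^'n"
  where "mat_poly A p = fold_coeffs (\<lambda>a Y. mat a + Y ** A) p 0"

lemma mat_poly_0 [simp]: "mat_poly A 0 = 0"
  by (simp add: mat_poly_def)

lemma mat_poly_pCons [simp]: "mat_poly A (pCons a p) = mat a + mat_poly A p ** A"
  by (cases "p = 0 \<and> a = 0") (auto simp: mat_poly_def)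

lemma mat_add: "mat (a + b) = mat a + mat b" for a :: complex
  by (simp add: vec_eq_iff mat_def)

lemma mat_poly_add: "mat_poly A (p + q) = mat_poly A p + mat_poly A q"
  by (induction p q rule: poly_induct2)
    (simp_all add: mat_add matrix_add_rdistrib)

lemma mat_poly_smult: "mat_poly A (smult c p) = mat c ** mat_poly A p"
proof (induction p)
  case (pCons a p)
  have "mat (c * a) = mat c ** (mat a :: complex^'n^'n)"
    by (simp add: vec_eq_iff mat_mult_nth) (simp add: mat_def)
  with pCons show ?case
    by (simp add: matrix_add_ldistrib matrix_mul_assoc)
qed simp

lemma mat_poly_sum: "mat_poly A (sum p S) = (\<Sum>i\<in>S. mat_poly A (p i))"
  by (induction S rule: infinite_finite_induct) (simp_all add: mat_poly_add)

text \<open>Scalar matrices commute with everything, so the factor can be put on the right, where it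
  acts first on a matrix \<open>X\<close> multiplied by the polynomial.\<close>

lemma mat_poly_linear_factor: "mat_poly A ([:- c, 1:] * q) = mat_poly A q ** (A - mat c)"
proof -
  have "mat_poly A ([:- c, 1:] * q) = mat (- c) ** mat_poly A q + mat_poly A q ** A"
  proof -
    have "[:- c, 1:] * q = smult (- c) q + pCons 0 q"
      by simp
    then show ?thesis
      by (simp only: mat_poly_add mat_poly_smult mat_poly_pCons) simp
  qed
  also have "mat (- c) ** mat_poly A q = - (mat_poly A q ** mat c)"
    by (simp add: vec_eq_iff mat_mult_nth mult_mat_nth)
  finally show ?thesis
    by (simp add: matrix_diff_ldistrib)
qed

text \<open>A dimension count replaces Cayley-Hamilton: one more power of \<open>A\<close> than the
  real dimension of the matrix space must be linearly dependent, and the coefficients of the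
  relation form \<open>p\<close>.\<close>

lemma annihilating_poly:
  fixes A :: "complex^'n^'n"
  obtains p where "p \<noteq> 0" "mat_poly A p = 0"
proof -
  define T where "T i = mat_poly A (monom 1 i)" for i
  have T: "mat_poly A (monom (of_real r) i) = r *\<^sub>R T i" for r i
  proof -
    have "mat_poly A (monom (of_real r) i) = mat (of_real r) ** T i"
      unfolding T_def mat_poly_smult[symmetric] by (simp add: smult_monom)
    then show ?thesis
      by (simp only: vec_eq_iff mat_mult_nth vector_scaleR_component) (simp add: scaleR_conv_of_real)
  qed
  let ?N = "DIM(complex^'n^'n)"
  show thesis
  \<comment> \<open>Dependence is a property of the set of powers. If two powers coincide, that set
    may be too small for the count, but then a difference of two monomials annihilates
    \<open>A\<close>.\<close>
  proof (cases "inj_on T {..?N}")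
    case True
    then have "card (T ` {..?N}) = Suc ?N"
      by (simp add: card_image)
    then have "dependent (T ` {..?N})"
      using independent_bound[of "T ` {..?N}"] by auto
    then obtain u j where u: "(\<Sum>v\<in>T ` {..?N}. u v *\<^sub>R v) = 0" and j: "j \<le> ?N" "u (T j) \<noteq> 0"
      by (auto simp: dependent_finite)
    define p where "p = (\<Sum>i\<le>?N. monom (complex_of_real (u (T i))) i)"
    have "coeff p j = of_real (u (T j))"
      using j by (simp add: p_def coeff_sum coeff_monom if_distrib cong: if_cong)
    then have "p \<noteq> 0"
      using j by auto
    moreover have "mat_poly A p = 0"
      using u unfolding sum.reindex[OF True] by (simp add: p_def mat_poly_sum T)
    ultimately show thesis
      by (rule that)
  next
    case False
    then obtain i j where ij: "i \<noteq> j" "T i = T j"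
      by (auto simp: inj_on_def)
    \<comment> \<open>The coefficient is written as \<open>of_real (- 1)\<close> to fit the
      real-scalar rule \<open>T\<close>.\<close>
    let ?p = "monom 1 i + monom (of_real (- 1)) j :: complex poly"
    have "coeff ?p i = 1"
      using ij by simp
    then have "?p \<noteq> 0"
      by (metis coeff_0 zero_neq_one)
    moreover have "mat_poly A ?p = 0"
      unfolding mat_poly_add T using ij by (simp add: T_def)
    ultimately show thesis
      by (rule that)
  qed
qed

text \<open>
  The solution space is invariant under \<open>X \<mapsto> A X\<close>, so it contains an eigenvector of this map as
  soon as it is nontrivial.
\<close>

lemma sylvester_eigen_solution:
  fixes A :: "complex^'n^'n" and B :: "complex^'m^'m" and X :: "complex^'m^'n"
  assumes "p \<noteq> 0" "mat_poly A p ** X = 0" "X \<noteq> 0" "A ** X + X ** B = 0"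
  shows "\<exists>c Y. Y \<noteq> 0 \<and> A ** Y = mat c ** Y \<and> A ** Y + Y ** B = 0"
  using assms
proof (induction "degree p" arbitrary: p X)
  case 0
  then obtain a where p: "p = [:a:]" "a \<noteq> 0"
    by (metis degree_eq_zeroE pCons_eq_0_iff)
  \<comment> \<open>A nonzero constant polynomial annihilates only \<open>X = 0\<close>, which
    contradicts the assumption.\<close>
  have "a * X $ i $ j = 0" for i j
    using 0 by (simp add: p flip: mat_mult_nth)
  with p 0 show ?case
    by (simp add: vec_eq_iff)
next
  case (Suc n)
  then have "\<not> constant (poly p)"
    by (simp add: constant_degree)
  then obtain c where "poly p c = 0"
    using fundamental_theorem_of_algebra by blast
  then obtain q where pq: "p = [:- c, 1:] * q"
    by (auto simp: poly_eq_0_iff_dvd elim: dvdE)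
  with Suc.prems have "q \<noteq> 0"
    by auto
  with Suc.hyps pq have deg: "n = degree q"
    by (simp add: degree_mult_eq del: mult_pCons_left)
  \<comment> \<open>For the root \<open>c\<close> of \<open>p\<close>, either \<open>X\<close> is
    itself an eigenvector, or \<open>Z\<close> is a nonzero solution annihilated by the cofactor
    \<open>q\<close> of smaller degree.\<close>
  define Z where "Z = A ** X - mat c ** X"
  show ?case
  proof (cases "Z = 0")
    case True
    then have "A ** X = mat c ** X"
      by (simp add: Z_def)
    with Suc.prems show ?thesis
      by blast
  next
    case False
    have "mat_poly A q ** Z = 0"
      using Suc.prems unfolding pq mat_poly_linear_factor Z_def
      by (simp add: matrix_diff_rdistrib flip: matrix_mul_assoc)
    moreover have "A ** Z + Z ** B = A ** (A ** X + X ** B) - mat c ** (A ** X + X ** B)"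
      unfolding Z_def
      by (simp add: matrix_diff_rdistrib matrix_diff_ldistrib matrix_add_ldistrib matrix_mul_assoc
          mat_mult_commute[of c A])
    then have "A ** Z + Z ** B = 0"
      by (simp add: Suc.prems)
    ultimately show ?thesis
      using Suc.hyps(1)[OF deg \<open>q \<noteq> 0\<close>] False by blast
  qed
qed

text \<open>A nonzero solution would yield an eigen-solution \<open>Y\<close> for some
  \<open>c\<close>. Its nonzero columns are eigenvectors of \<open>A\<close> for \<open>c\<close>,
  and its nonzero conjugated rows are eigenvectors of \<open>F\<close> for \<open>- cnj c\<close>.
  Hence \<open>Re c < 0\<close> and \<open>- Re c \<le> 0\<close>, a contradiction.\<close>

lemma sylvester_unique:
  fixes A :: "complex^'n^'n" and F :: "complex^'m^'m" and X :: "complex^'m^'n"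
  assumes A: "hurwitz A"
    and F: "\<And>d w. F *v w = d *s w \<Longrightarrow> w \<noteq> 0 \<Longrightarrow> Re d \<le> 0"
    and X: "A ** X + X ** F\<^sup>\<dagger> = 0"
  shows "X = 0"
proof (rule ccontr)
  assume "X \<noteq> 0"
  obtain p where "p \<noteq> 0" "mat_poly A p = 0"
    by (rule annihilating_poly)
  then obtain c Y where Y: "Y \<noteq> 0" "A ** Y = mat c ** Y" "A ** Y + Y ** F\<^sup>\<dagger> = 0"
    using sylvester_eigen_solution[of p A X "F\<^sup>\<dagger>"] \<open>X \<noteq> 0\<close> X by auto
  \<comment> \<open>One nonzero entry guarantees that both its column and its row are
    nonzero.\<close>
  from Y obtain i j where ij: "Y $ i $ j \<noteq> 0"
    by (auto simp: vec_eq_iff)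
  define v where "v = (\<chi> k. Y $ k $ j)"
  have "(A *v v) $ k = (A ** Y) $ k $ j" for k
    by (simp add: v_def matrix_vector_mult_def matrix_matrix_mult_def)
  then have "A *v v = c *s v"
    by (simp add: vec_eq_iff Y mat_mult_nth) (simp add: v_def)
  moreover have "v \<noteq> 0"
    using ij by (auto simp: v_def vec_eq_iff)
  ultimately have "Re c < 0"
    using A by (auto simp: hurwitz_def)
  define w where "w = (\<chi> k. cnj (Y $ i $ k))"
  have "Y ** F\<^sup>\<dagger> = - (mat c ** Y)"
    using Y by (metis add_eq_0_iff)
  then have YF: "(Y ** F\<^sup>\<dagger>) $ i $ k = - (c * Y $ i $ k)" for k
    by (simp add: mat_mult_nth)
  have "(F *v w) $ k = cnj ((Y ** F\<^sup>\<dagger>) $ i $ k)" for k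
    by (simp add: w_def matrix_vector_mult_def matrix_matrix_mult_def dagger_nth mult.commute)
  then have "F *v w = (- cnj c) *s w"
    by (simp add: vec_eq_iff YF) (simp add: w_def)
  moreover have "w \<noteq> 0"
    using ij by (auto simp: w_def vec_eq_iff)
  ultimately have "Re (- cnj c) \<le> 0"
    by (rule F)
  with \<open>Re c < 0\<close> show False
    by simp
qed

section \<open>Equality of the costs\<close>

lemma kalman_covariance_eq_commutation_matrix:
  assumes pd: "positive_definite \<Theta>"
    and lyap: "F ** \<Theta> + \<Theta> ** F\<^sup>\<dagger> + G ** G\<^sup>\<dagger> = 0"
    and gain: "G ** K\<^sup>\<dagger> + \<Theta> ** H\<^sup>\<dagger> = 0"
    and P: "kalman_covariance F G H K M P"
  shows "P = \<Theta>"
proof -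
  define X where "X = P - \<Theta>"
  define S where "S = matrix_inv (M ** K ** K\<^sup>\<dagger> ** M\<^sup>\<dagger>)"
  define A where "A = F - kalman_gain G H K M P ** M ** H"
  have "X\<^sup>\<dagger> = X"
    using pd P by (simp add: X_def kalman_covariance_def hermitian_def positive_definite_cinner dagger_diff)
  \<comment> \<open>Since the contribution of \<open>\<Theta>\<close> cancels against
    \<open>G ** K\<^sup>\<dagger>\<close>, the Riccati correction becomes quadratic in
    \<open>X\<close>.\<close>
  have GP: "G ** K\<^sup>\<dagger> + P ** H\<^sup>\<dagger> = X ** H\<^sup>\<dagger>"
    using gain by (simp add: X_def matrix_diff_rdistrib add_eq_0_iff)
  have A: "A = F - X ** H\<^sup>\<dagger> ** M\<^sup>\<dagger> ** S ** M ** H"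
    by (simp add: A_def kalman_gain_def GP S_def)
  have "F ** P + P ** F\<^sup>\<dagger> + G ** G\<^sup>\<dagger> - X ** H\<^sup>\<dagger> ** M\<^sup>\<dagger> ** S ** M ** (X ** H\<^sup>\<dagger>)\<^sup>\<dagger> = 0"
    using P by (simp add: kalman_covariance_def GP S_def)
  then have "F ** P + P ** F\<^sup>\<dagger> + G ** G\<^sup>\<dagger> - X ** H\<^sup>\<dagger> ** M\<^sup>\<dagger> ** S ** M ** H ** X = 0"
    by (simp add: dagger_mult \<open>X\<^sup>\<dagger> = X\<close> matrix_mul_assoc)
  \<comment> \<open>Riccati minus Lyapunov: the quadratic term is absorbed into the closed-loop
    matrix \<open>A\<close>, leaving an equation of Sylvester form.\<close>
  moreover have "A ** X + X ** F\<^sup>\<dagger> =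
      (F ** P + P ** F\<^sup>\<dagger> + G ** G\<^sup>\<dagger> - X ** H\<^sup>\<dagger> ** M\<^sup>\<dagger> ** S ** M ** H ** X)
      - (F ** \<Theta> + \<Theta> ** F\<^sup>\<dagger> + G ** G\<^sup>\<dagger>)"
  proof -
    have "F ** X = F ** P - F ** \<Theta>" "X ** F\<^sup>\<dagger> = P ** F\<^sup>\<dagger> - \<Theta> ** F\<^sup>\<dagger>"
      by (simp_all add: X_def matrix_diff_rdistrib matrix_diff_ldistrib)
    moreover have "A ** X = F ** X - X ** H\<^sup>\<dagger> ** M\<^sup>\<dagger> ** S ** M ** H ** X"
      by (simp add: A matrix_diff_rdistrib)
    ultimately show ?thesis
      by simp
  qed
  ultimately have "A ** X + X ** F\<^sup>\<dagger> = 0"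
    by (simp add: lyap)
  moreover have "hurwitz A"
    using P by (simp add: kalman_covariance_def A_def)
  ultimately have "X = 0"
    using sylvester_unique lyapunov_eigenvalue[OF pd lyap] by blast
  then show ?thesis
    by (simp add: X_def)
qed

text \<open>Serves plant and controller alike. The relations for \<open>H1 ** \<Theta>\<close> and
  \<open>H2 ** \<Theta>\<close> are the adjoints of the coupling conditions, as
  \<open>\<Theta>\<close> is Hermitian.\<close>

lemma physically_realizable_two_channelsE:
  assumes "physically_realizable F (hcat G1 G2) (vcat H1 H2) (block_mat K11 K12 K21 K22)"
  obtains \<Theta> where "positive_definite \<Theta>"
    "F ** \<Theta> + \<Theta> ** F\<^sup>\<dagger> + G1 ** G1\<^sup>\<dagger> + G2 ** G2\<^sup>\<dagger> = 0"
    "\<Theta> ** H1\<^sup>\<dagger> = - G1" "\<Theta> ** H2\<^sup>\<dagger> = - G2" "H1 ** \<Theta> = - G1\<^sup>\<dagger>" "H2 ** \<Theta> = - G2\<^sup>\<dagger>"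
    "K11 = mat 1" "K12 = 0" "K21 = 0" "K22 = mat 1"
proof -
  from assms obtain \<Theta> where pd: "positive_definite \<Theta>"
    and lyap: "F ** \<Theta> + \<Theta> ** F\<^sup>\<dagger> + hcat G1 G2 ** (hcat G1 G2)\<^sup>\<dagger> = 0"
    and G: "hcat G1 G2 = - (\<Theta> ** (vcat H1 H2)\<^sup>\<dagger>)"
    and K: "block_mat K11 K12 K21 K22 = mat 1"
    by (auto simp: physically_realizable_def)
  have G': "\<Theta> ** H1\<^sup>\<dagger> = - G1" "\<Theta> ** H2\<^sup>\<dagger> = - G2"
    using G by (simp_all add: dagger_vcat mult_hcat hcat_minus hcat_eq_iff)
  have "\<Theta>\<^sup>\<dagger> = \<Theta>"
    using pd by (simp add: positive_definite_cinner)
  then have "H1 ** \<Theta> = (\<Theta> ** H1\<^sup>\<dagger>)\<^sup>\<dagger>" "H2 ** \<Theta> = (\<Theta> ** H2\<^sup>\<dagger>)\<^sup>\<dagger>"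
    by (simp_all add: dagger_mult)
  then have "H1 ** \<Theta> = - G1\<^sup>\<dagger>" "H2 ** \<Theta> = - G2\<^sup>\<dagger>"
    by (simp_all add: G' dagger_minus)
  moreover have "K11 = mat 1" "K12 = 0" "K21 = 0" "K22 = mat 1"
    using K by (simp_all add: mat_eq_block_mat block_mat_def hcat_eq_iff vcat_eq_iff)
  ultimately show thesis
    using that pd lyap G' by (simp add: block_simps add.assoc)
qed

theorem theorem5p1:
  fixes F :: "complex^('n::finite + 'n)^('n + 'n)"
    and G1 G2 :: "complex^('m::finite + 'm)^('n + 'n)"
    and H :: "complex^('n + 'n)^('m + 'm)"
    and K :: "complex^('m + 'm)^('m + 'm)"
    and C :: "complex^('n + 'n)^1"
    and Fc :: "complex^('l::finite + 'l)^('l + 'l)"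
    and Gc1 :: "complex^('k::finite + 'k)^('l + 'l)"
    and Gc2 :: "complex^('m + 'm)^('l + 'l)"
    and Hct :: "complex^('l + 'l)^('k + 'k)"
    and Hc :: "complex^('l + 'l)^('m + 'm)"
    and Kct1 :: "complex^('k + 'k)^('k + 'k)"
    and Kct2 :: "complex^('m + 'm)^('k + 'k)"
    and Kc1 :: "complex^('k + 'k)^('m + 'm)"
    and Kc2 :: "complex^('m + 'm)^('m + 'm)"
    and \<theta> :: "real^'m"
    and \<theta>t :: "real^'k"
    and Jc_bar Jc_tilde :: complex
  assumes plant_annihilation_only:
      "annihilation_only F" "annihilation_only G1" "annihilation_only G2"
      "annihilation_only H" "annihilation_only K"
    and plant_realizable: "plant_realizable F G1 G2 H K"
    and controller_annihilation_only:
      "annihilation_only Fc" "annihilation_only Gc1" "annihilation_only Gc2"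
      "annihilation_only Hct" "annihilation_only Hc"
      "annihilation_only Kct1" "annihilation_only Kct2"
      "annihilation_only Kc1" "annihilation_only Kc2"
    and controller_realizable:
      "physically_realizable Fc (hcat Gc1 Gc2) (vcat Hct Hc) (block_mat Kct1 Kct2 Kc1 Kc2)"
    and purely_classical_cost:
      "is_estimation_cost F (hcat G1 G2) H (hcat K 0) (homodyne \<theta>) C Jc_bar"
    and coherent_classical_cost:
      "is_estimation_cost
         (block_mat (F + G2 ** Kc2 ** H) (G2 ** Hc) (Gc2 ** H) Fc)
         (block_mat (G1 + G2 ** Kc2 ** K) (G2 ** Kc1) (Gc2 ** K) Gc1)
         (hcat (Kct2 ** H) Hct)
         (hcat (Kct2 ** K) Kct1)
         (homodyne \<theta>t)
         (hcat C 0)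
         Jc_tilde"
  shows "Jc_tilde = Jc_bar"
proof -
  from plant_realizable obtain Hbar Kbar where
    "physically_realizable F (hcat G1 G2) (vcat H Hbar) (block_mat K 0 0 Kbar)"
    by (auto simp: plant_realizable_def)
  then obtain \<Theta> where pd: "positive_definite \<Theta>"
    and lyap: "F ** \<Theta> + \<Theta> ** F\<^sup>\<dagger> + G1 ** G1\<^sup>\<dagger> + G2 ** G2\<^sup>\<dagger> = 0"
    and H: "\<Theta> ** H\<^sup>\<dagger> = - G1" "H ** \<Theta> = - G1\<^sup>\<dagger>" and K: "K = mat 1"
    by (rule physically_realizable_two_channelsE)
  from controller_realizable obtain \<Theta>c where pdc: "positive_definite \<Theta>c"
    and lyapc: "Fc ** \<Theta>c + \<Theta>c ** Fc\<^sup>\<dagger> + Gc1 ** Gc1\<^sup>\<dagger> + Gc2 ** Gc2\<^sup>\<dagger> = 0"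
    and Hc: "\<Theta>c ** Hct\<^sup>\<dagger> = - Gc1" "\<Theta>c ** Hc\<^sup>\<dagger> = - Gc2" "Hc ** \<Theta>c = - Gc2\<^sup>\<dagger>"
    and Kc: "Kct1 = mat 1" "Kct2 = 0" "Kc1 = 0" "Kc2 = mat 1"
    by (rule physically_realizable_two_channelsE)
  \<comment> \<open>The interconnection after inserting the identity and zero feedthrough blocks. In
    \<open>?\<Theta>a\<close> the plant and the controller are uncorrelated.\<close>
  let ?Fa = "block_mat (F + G2 ** H) (G2 ** Hc) (Gc2 ** H) Fc"
  let ?Ga = "block_mat (G1 + G2) 0 Gc2 Gc1"
  let ?\<Theta>a = "block_mat \<Theta> 0 0 \<Theta>c"

  from purely_classical_cost obtain P where
    P: "kalman_covariance F (hcat G1 G2) H (hcat K 0) (homodyne \<theta>) P" "Jc_bar = (C ** P ** C\<^sup>\<dagger>) $ 1 $ 1"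
    by (auto simp: is_estimation_cost_def)
  have "P = \<Theta>"
    using pd _ _ P(1)
  proof (rule kalman_covariance_eq_commutation_matrix)
    show "F ** \<Theta> + \<Theta> ** F\<^sup>\<dagger> + hcat G1 G2 ** (hcat G1 G2)\<^sup>\<dagger> = 0"
      using lyap by (simp add: block_simps add.assoc)
    show "hcat G1 G2 ** (hcat K 0)\<^sup>\<dagger> + \<Theta> ** H\<^sup>\<dagger> = 0"
      by (simp add: block_simps H K dagger_mat)
  qed

  from coherent_classical_cost obtain Q where
    Q: "kalman_covariance ?Fa ?Ga (hcat 0 Hct) (hcat 0 (mat 1)) (homodyne \<theta>t) Q"
      "Jc_tilde = (hcat C 0 ** Q ** (hcat C 0)\<^sup>\<dagger>) $ 1 $ 1"
    by (auto simp: is_estimation_cost_def K Kc)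
  have "Q = ?\<Theta>a"
    using positive_definite_block_diag[OF pd pdc] _ _ Q(1)
  proof (rule kalman_covariance_eq_commutation_matrix)
    \<comment> \<open>The feedback terms
      \<open>G2 ** H ** \<Theta> = - (G2 ** G1\<^sup>\<dagger>)\<close> and its adjoint cancel the
      cross terms of \<open>G1 + G2\<close>, which leaves the Lyapunov expression of the plant
      alone.\<close>
    have "(F + G2 ** H) ** \<Theta> + \<Theta> ** (F + G2 ** H)\<^sup>\<dagger> + (G1 + G2) ** (G1 + G2)\<^sup>\<dagger>
        = F ** \<Theta> + \<Theta> ** F\<^sup>\<dagger> + G1 ** G1\<^sup>\<dagger> + G2 ** G2\<^sup>\<dagger>"
      by (simp add: dagger_add dagger_mult matrix_add_ldistrib matrix_add_rdistrib H matrix_mul_assoc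
          matrix_mul_minus_left matrix_mul_minus_right flip: matrix_mul_assoc[of _ H \<Theta>])
    \<comment> \<open>In the off-diagonal block, the coupling conditions of the controller and the
      plant produce \<open>- (G2 ** Gc2\<^sup>\<dagger>)\<close> and
      \<open>- (G1 ** Gc2\<^sup>\<dagger>)\<close>, cancelling the noise term.\<close>
    moreover have "G2 ** Hc ** \<Theta>c + \<Theta> ** (Gc2 ** H)\<^sup>\<dagger> + (G1 + G2) ** Gc2\<^sup>\<dagger> = 0"
      by (simp add: dagger_mult matrix_add_rdistrib H Hc matrix_mul_assoc
          matrix_mul_minus_left matrix_mul_minus_right flip: matrix_mul_assoc[of _ Hc \<Theta>c])
    moreover have "Gc2 ** H ** \<Theta> + \<Theta>c ** (G2 ** Hc)\<^sup>\<dagger> + Gc2 ** (G1 + G2)\<^sup>\<dagger> = 0"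
      by (simp add: dagger_mult dagger_add matrix_add_ldistrib H Hc matrix_mul_assoc
          matrix_mul_minus_left matrix_mul_minus_right flip: matrix_mul_assoc[of _ H \<Theta>])
    moreover have "Fc ** \<Theta>c + \<Theta>c ** Fc\<^sup>\<dagger> + (Gc2 ** Gc2\<^sup>\<dagger> + Gc1 ** Gc1\<^sup>\<dagger>) = 0"
      using lyapc by (simp add: ac_simps)
    ultimately show "?Fa ** ?\<Theta>a + ?\<Theta>a ** ?Fa\<^sup>\<dagger> + ?Ga ** ?Ga\<^sup>\<dagger> = 0"
      using lyap by (simp add: block_simps hcat_zero vcat_zero)
    \<comment> \<open>The detected field sees only the controller through \<open>Hct\<close>, so the
      zero-gain condition reduces to
      \<open>\<Theta>c ** Hct\<^sup>\<dagger> = - Gc1\<close>.\<close>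
    show "?Ga ** (hcat 0 (mat 1))\<^sup>\<dagger> + ?\<Theta>a ** (hcat 0 Hct)\<^sup>\<dagger> = 0"
      by (simp add: block_simps Hc dagger_mat vcat_zero)
  qed
  \<comment> \<open>The row \<open>hcat C 0\<close> selects the plant block of
    \<open>?\<Theta>a\<close>, so both costs are the entry of
    \<open>C ** \<Theta> ** C\<^sup>\<dagger>\<close>.\<close>
  with \<open>P = \<Theta>\<close> P(2) Q(2) show ?thesis
    by (simp add: block_simps)
qed

end
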